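(* Let $G$ be a finite simple graph with minimum degree $\delta \ge 3$ and a cut vertex $v$ such that $G - v$ has a connected component with girth at least $5$. Then $3\delta - 6 \le Z(G)$.
   Context: A cut vertex is a vertex whose removal increases the number of connected components. The girth of a graph is the length of a shortest cycle (infinite if acyclic). Zero forcing process: start with an initial set $S$ of colored vertices. A colored vertex $u$ forces an uncolored neighbor $w$ (making $w$ colored) if $w$ is the only uncolored neighbor of $u$; forces are applied repeatedly. $S$ is a zero forcing set if eventually every vertex becomes colored. $Z(G)$ is the minimum size of a zero forcing set. *)

theory Defs
  imports "Graph_Theory.Graph_Theory" "HOL-Library.Extended_Nat"
begin

text \<open>
  Finite simple graphs are the locale \<^locale>\<open>graph\<close>: finite, loop-free, symmetric digraphs without
  parallel arcs, so an edge is a pair of opposite arcs. Hence the degree of a vertex is its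
  out-degree, and the connected components are the strongly connected components
  \<^const>\<open>pre_digraph.sccs\<close>.
\<close>

definition min_degree :: "('a, 'b) pre_digraph \<Rightarrow> nat" where
  "min_degree G = Min (out_degree G ` verts G)"

definition cut_vertex :: "('a, 'b) pre_digraph \<Rightarrow> 'a \<Rightarrow> bool" where
  "cut_vertex G v \<longleftrightarrow> v \<in> verts G \<and>
     card (pre_digraph.sccs G) < card (pre_digraph.sccs (pre_digraph.del_vert G v))"

text \<open>
  The bound \<open>3 \<le> length p\<close> excludes the directed 2-cycles formed by the two arcs of one edge.
  The infimum over the empty set is \<open>\<infinity>\<close>.
\<close>

definition girth :: "('a, 'b) pre_digraph \<Rightarrow> enat" where
  "girth G = (INF p \<in> {p. pre_digraph.cycle G p \<and> 3 \<le> length p}. enat (length p))"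

definition forces :: "('a, 'b) pre_digraph \<Rightarrow> 'a set \<Rightarrow> 'a \<Rightarrow> 'a \<Rightarrow> bool" where
  "forces G A u w \<longleftrightarrow> u \<in> A \<and> {x. u \<rightarrow>\<^bsub>G\<^esub> x \<and> x \<notin> A} = {w}"

definition force_step :: "('a, 'b) pre_digraph \<Rightarrow> 'a set \<Rightarrow> 'a set \<Rightarrow> bool" where
  "force_step G A B \<longleftrightarrow> (\<exists>u w. forces G A u w \<and> B = insert w A)"

definition zero_forcing_set :: "('a, 'b) pre_digraph \<Rightarrow> 'a set \<Rightarrow> bool" where
  "zero_forcing_set G S \<longleftrightarrow> S \<subseteq> verts G \<and> (force_step G)\<^sup>*\<^sup>* S (verts G)"

definition zero_forcing_number :: "('a, 'b) pre_digraph \<Rightarrow> nat" where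
  "zero_forcing_number G = (LEAST k. \<exists>S. zero_forcing_set G S \<and> card S = k)"

end

theory Submission
  imports Defs
begin

text \<open>
  Deleting the cut vertex \<open>v\<close> costs at most one: as \<open>v\<close> performs at most one force, adding the
  vertex forced by \<open>v\<close> to a zero forcing set of \<open>G\<close> gives a set that forces every component of
  \<open>G - v\<close> on its own. These components have minimum degree at least \<open>\<delta> - 1\<close>. The first force
  in a component shows that the set contains at least \<open>\<delta> - 1\<close> of its vertices. In a component of
  girth at least 5, two distinct closed neighbourhoods cover at least \<open>2(\<delta> - 1)\<close> vertices, and
  after the first two forces such a pair is coloured, so the set contains at least
  \<open>2(\<delta> - 1) - 2\<close> vertices there. In total \<open>Z(G) + 1 \<ge> (\<delta> - 1) + (2\<delta> - 4)\<close>.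
\<close>

section \<open>Zero forcing inside a set of vertices\<close>

definition nbhd_in :: "('a, 'b) pre_digraph \<Rightarrow> 'a set \<Rightarrow> 'a \<Rightarrow> 'a set" where
  "nbhd_in G X u = {x \<in> X. u \<rightarrow>\<^bsub>G\<^esub> x}"

text \<open>
  Zero forcing in the subgraph induced on \<open>X\<close>, phrased without forcing sequences: no proper
  subset of \<open>X\<close> that contains the start set is stalled.
\<close>

definition forces_within :: "('a, 'b) pre_digraph \<Rightarrow> 'a set \<Rightarrow> 'a set \<Rightarrow> bool" where
  "forces_within G X S \<longleftrightarrow>
     (\<forall>T. S \<inter> X \<subseteq> T \<and> T \<subset> X \<longrightarrow> (\<exists>u \<in> T. \<exists>w. nbhd_in G X u - T = {w}))"

lemma nbhd_in_subset: "nbhd_in G X u \<subseteq> X"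
  by (auto simp: nbhd_in_def)

lemma forces_withinD:
  assumes "forces_within G X S" "S \<inter> X \<subseteq> T" "T \<subset> X"
  obtains u w where "u \<in> T" "nbhd_in G X u - T = {w}"
  using assms unfolding forces_within_def by metis

text \<open>Colouring all of \<open>X - Y\<close> has no effect inside \<open>Y\<close>, as no edge
  within \<open>X\<close> leaves \<open>Y\<close>: any force available from
  \<open>T \<union> (X - Y)\<close> colours a vertex of \<open>Y\<close>, so it is performed by a
  vertex of \<open>Y\<close>. This passes from \<open>G - v\<close> to its components.\<close>

lemma forces_within_closed_subset:
  assumes forces: "forces_within G X S"
    and "Y \<subseteq> X"
    and closed: "\<And>u w. u \<in> X \<Longrightarrow> w \<in> X \<Longrightarrow> u \<rightarrow>\<^bsub>G\<^esub> w \<Longrightarrow> u \<in> Y \<longleftrightarrow> w \<in> Y"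
  shows "forces_within G Y S"
  unfolding forces_within_def
proof (intro allI impI)
  fix T assume T: "S \<inter> Y \<subseteq> T \<and> T \<subset> Y"
  have "S \<inter> X \<subseteq> T \<union> (X - Y)" "T \<union> (X - Y) \<subset> X"
    using T \<open>Y \<subseteq> X\<close> by auto
  from forces_withinD[OF forces this]
  obtain u w where u: "u \<in> T \<union> (X - Y)" and w: "nbhd_in G X u - (T \<union> (X - Y)) = {w}" .
  have "w \<in> X" "w \<in> Y" "u \<rightarrow>\<^bsub>G\<^esub> w" "u \<in> X"
    using w u T \<open>Y \<subseteq> X\<close> by (auto simp: nbhd_in_def)
  with closed have "u \<in> Y" by blast
  moreover have "nbhd_in G Y u - T = nbhd_in G X u - (T \<union> (X - Y))"
    using \<open>Y \<subseteq> X\<close> by (auto simp: nbhd_in_def)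
  ultimately show "\<exists>u \<in> T. \<exists>w. nbhd_in G Y u - T = {w}"
    using u w by auto
qed

text \<open>Follow the forcing sequence of \<open>G\<close> up to the first vertex of
  \<open>G - v\<close> missing from \<open>T\<close>: its forcer can still act from
  \<open>T\<close>, unless that forcer is \<open>v\<close>. The vertex \<open>z\<close> makes up for
  this single lost force.\<close>

lemma (in loopfree_digraph) forces_within_vertex_deletion:
  assumes "zero_forcing_set G S"
  shows "\<exists>z. forces_within G (verts G - {v}) (insert z S)"
proof -
  let ?X = "verts G - {v}"
  let ?active = "\<lambda>T. \<exists>u \<in> T. \<exists>w. nbhd_in G ?X u - T = {w}"
  \<comment> \<open>Either \<open>v\<close> has not forced yet, or it forced \<open>z\<close> and, its neighbours being coloured, is done.\<close>
  have invariant: "(\<forall>T. S \<inter> ?X \<subseteq> T \<longrightarrow> \<not> B \<inter> ?X \<subseteq> T \<longrightarrow> ?active T) \<or>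
      (\<exists>z. (\<forall>x. v \<rightarrow>\<^bsub>G\<^esub> x \<longrightarrow> x \<in> B) \<and>
        (\<forall>T. insert z S \<inter> ?X \<subseteq> T \<longrightarrow> \<not> B \<inter> ?X \<subseteq> T \<longrightarrow> ?active T))"
    if "(force_step G)\<^sup>*\<^sup>* S B" for B
    using that
  proof (induction rule: rtranclp_induct)
    case base
    show ?case by blast
  next
    case (step B B')
    then obtain u w where "u \<in> B" and uw: "{x. u \<rightarrow>\<^bsub>G\<^esub> x \<and> x \<notin> B} = {w}"
      and B': "B' = insert w B"
      by (auto simp: force_step_def forces_def)
    then have "u \<rightarrow>\<^bsub>G\<^esub> w" by auto
    show ?case
    proof (cases "u = v")
      case False
      \<comment> \<open>If \<open>T\<close> already misses a vertex of \<open>B\<close> in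
        \<open>G - v\<close>, the induction hypothesis applies; the new case is that
        \<open>w\<close> is the first vertex missed.\<close>
      have "?active T" if "B \<inter> ?X \<subseteq> T" "\<not> B' \<inter> ?X \<subseteq> T" for T
      proof -
        have "u \<in> T"
          using \<open>u \<in> B\<close> \<open>u \<rightarrow>\<^bsub>G\<^esub> w\<close> False that(1) by (auto dest: adj_in_verts)
        moreover have "nbhd_in G ?X u - T = {w}"
          using that uw B' by (auto simp: nbhd_in_def)
        ultimately show ?thesis by blast
      qed
      then show ?thesis
        using step.IH B' by (metis insertCI)
    next
      case True
      have full: "\<forall>x. v \<rightarrow>\<^bsub>G\<^esub> x \<longrightarrow> x \<in> B'"
        using uw B' True by auto
      \<comment> \<open>\<open>w\<close> was an uncoloured neighbour of \<open>v\<close>, which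
        rules out that \<open>v\<close> has forced before; so \<open>w\<close> can become
        \<open>z\<close>.\<close>
      have "\<not> (\<forall>x. v \<rightarrow>\<^bsub>G\<^esub> x \<longrightarrow> x \<in> B)"
        using uw True by auto
      with step.IH have "?active T" if "S \<inter> ?X \<subseteq> T" "\<not> B \<inter> ?X \<subseteq> T" for T
        using that by blast
      moreover have "w \<in> ?X"
        using \<open>u \<rightarrow>\<^bsub>G\<^esub> w\<close> True by (auto dest: adj_in_verts adj_not_same)
      ultimately have "\<forall>T. insert w S \<inter> ?X \<subseteq> T \<longrightarrow> \<not> B' \<inter> ?X \<subseteq> T \<longrightarrow> ?active T"
        using B' by auto
      with full show ?thesis by blast
    qed
  qed
  have "(force_step G)\<^sup>*\<^sup>* S (verts G)"
    using assms by (simp add: zero_forcing_set_def)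
  from invariant[OF this] show ?thesis
  proof (elim disjE exE conjE)
    assume "\<forall>T. S \<inter> ?X \<subseteq> T \<longrightarrow> \<not> verts G \<inter> ?X \<subseteq> T \<longrightarrow> ?active T"
    \<comment> \<open>Here \<open>v\<close> serves as a dummy \<open>z\<close>: it lies outside
      \<open>?X\<close> and adds nothing.\<close>
    then have "?active T" if "insert v S \<inter> ?X \<subseteq> T" "T \<subset> ?X" for T
      using that by (elim allE[of _ T]) auto
    then have "forces_within G ?X (insert v S)"
      unfolding forces_within_def by simp
    then show ?thesis ..
  next
    fix z
    assume "\<forall>T. insert z S \<inter> ?X \<subseteq> T \<longrightarrow> \<not> verts G \<inter> ?X \<subseteq> T \<longrightarrow> ?active T"
    then have "?active T" if "insert z S \<inter> ?X \<subseteq> T" "T \<subset> ?X" for T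
      using that by (elim allE[of _ T]) auto
    then have "forces_within G ?X (insert z S)"
      unfolding forces_within_def by simp
    then show ?thesis ..
  qed
qed

section \<open>Lower bounds on start sets from degree and short cycles\<close>

lemma forces_within_card_ge:
  assumes "forces_within G X S" "finite X" "X \<noteq> {}"
    and irrefl: "\<And>u. \<not> u \<rightarrow>\<^bsub>G\<^esub> u"
    and deg: "\<And>u. u \<in> X \<Longrightarrow> d \<le> card (nbhd_in G X u)"
  shows "d \<le> card (S \<inter> X)"
proof (cases "X \<subseteq> S")
  case True
  then have "S \<inter> X = X" by auto
  then show ?thesis
    using assms(2,3) deg card_mono[OF \<open>finite X\<close> nbhd_in_subset] by (metis all_not_in_conv le_trans)
next
  case False
  then have "S \<inter> X \<subset> X" by auto
  from forces_withinD[OF assms(1) subset_refl this]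
  obtain u w where u: "u \<in> S \<inter> X" and w: "nbhd_in G X u - S \<inter> X = {w}" .
  have fin: "finite (nbhd_in G X u)" "finite (S \<inter> X)"
    using \<open>finite X\<close> by (auto intro: finite_subset[OF nbhd_in_subset])
  have "u \<notin> nbhd_in G X u"
    using irrefl by (simp add: nbhd_in_def)
  \<comment> \<open>The closed neighbourhood of the first forcing vertex is coloured except for
    \<open>w\<close>.\<close>
  then have "Suc d \<le> card (insert u (nbhd_in G X u))"
    using fin u deg by simp
  also have "\<dots> \<le> card (insert w (S \<inter> X))"
    using u w fin by (intro card_mono) auto
  also have "\<dots> \<le> Suc (card (S \<inter> X))"
    by (rule card_insert_le_m1) auto
  finally show ?thesis by simp
qed

text \<open>Each closed neighbourhood has at least \<open>d + 1\<close> vertices, and the two share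
  at most two: only \<open>u\<close> and \<open>x\<close> if these are adjacent (no triangle),
  otherwise at most one common neighbour (no 4-cycle).\<close>

lemma card_two_closed_nbhds_ge:
  assumes "finite X" "u \<in> X" "x \<in> X" "u \<noteq> x"
    and irrefl: "\<And>a. \<not> a \<rightarrow>\<^bsub>G\<^esub> a"
    and sym: "\<And>a b. a \<rightarrow>\<^bsub>G\<^esub> b \<Longrightarrow> b \<rightarrow>\<^bsub>G\<^esub> a"
    and deg: "\<And>a. a \<in> X \<Longrightarrow> d \<le> card (nbhd_in G X a)"
    and no_C3: "\<And>a b c. {a, b, c} \<subseteq> X \<Longrightarrow> a \<rightarrow>\<^bsub>G\<^esub> b \<Longrightarrow> b \<rightarrow>\<^bsub>G\<^esub> c \<Longrightarrow> \<not> c \<rightarrow>\<^bsub>G\<^esub> a"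
    and no_C4: "\<And>a b c e. {a, b, c, e} \<subseteq> X \<Longrightarrow> a \<noteq> c \<Longrightarrow> b \<noteq> e \<Longrightarrow>
      a \<rightarrow>\<^bsub>G\<^esub> b \<Longrightarrow> b \<rightarrow>\<^bsub>G\<^esub> c \<Longrightarrow> c \<rightarrow>\<^bsub>G\<^esub> e \<Longrightarrow> \<not> e \<rightarrow>\<^bsub>G\<^esub> a"
  shows "2 * d \<le> card (insert u (nbhd_in G X u) \<union> insert x (nbhd_in G X x))"
proof -
  let ?U = "insert u (nbhd_in G X u)" and ?V = "insert x (nbhd_in G X x)"
  have fin: "finite (nbhd_in G X a)" for a
    using \<open>finite X\<close> by (rule finite_subset[OF nbhd_in_subset])
  have size: "Suc d \<le> card (insert a (nbhd_in G X a))" if "a \<in> X" for a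
    using irrefl deg[OF that] fin[of a] by (simp add: nbhd_in_def)
  have "card (?U \<inter> ?V) \<le> 2"
  proof (cases "u \<rightarrow>\<^bsub>G\<^esub> x")
    case True
    have "?U \<inter> ?V \<subseteq> {u, x}"
      using True no_C3[of u x] \<open>u \<in> X\<close> \<open>x \<in> X\<close> by (auto simp: nbhd_in_def dest: sym)
    then have "card (?U \<inter> ?V) \<le> card {u, x}" by (intro card_mono) auto
    then show ?thesis using \<open>u \<noteq> x\<close> by simp
  next
    case False
    then have "?U \<inter> ?V = nbhd_in G X u \<inter> nbhd_in G X x"
      using \<open>u \<noteq> x\<close> by (auto simp: nbhd_in_def dest: sym)
    moreover have "a = b" if "a \<in> nbhd_in G X u \<inter> nbhd_in G X x"
      "b \<in> nbhd_in G X u \<inter> nbhd_in G X x" for a b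
      using that no_C4[of u a x b] \<open>u \<in> X\<close> \<open>x \<in> X\<close> \<open>u \<noteq> x\<close>
      by (auto simp: nbhd_in_def dest: sym)
    ultimately have "card (?U \<inter> ?V) \<le> Suc 0"
      using fin by (simp add: card_le_Suc0_iff_eq)
    then show ?thesis by simp
  qed
  moreover have "card ?U + card ?V = card (?U \<union> ?V) + card (?U \<inter> ?V)"
    using fin by (intro card_Un_Int) auto
  ultimately show ?thesis
    using size[OF \<open>u \<in> X\<close>] size[OF \<open>x \<in> X\<close>] by linarith
qed

text \<open>\<open>u\<close> and \<open>x\<close> perform the first two forces and \<open>w\<close>
  and \<open>y\<close> are the vertices coloured. Their closed neighbourhoods then lie in the start
  set with \<open>w\<close> and \<open>y\<close> added.\<close>

lemma forces_within_card_ge_girth_5: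
  assumes forces: "forces_within G X S" and "finite X" "X \<noteq> {}" "1 \<le> d"
    and irrefl: "\<And>a. \<not> a \<rightarrow>\<^bsub>G\<^esub> a"
    and sym: "\<And>a b. a \<rightarrow>\<^bsub>G\<^esub> b \<Longrightarrow> b \<rightarrow>\<^bsub>G\<^esub> a"
    and deg: "\<And>a. a \<in> X \<Longrightarrow> d \<le> card (nbhd_in G X a)"
    and no_C3: "\<And>a b c. {a, b, c} \<subseteq> X \<Longrightarrow> a \<rightarrow>\<^bsub>G\<^esub> b \<Longrightarrow> b \<rightarrow>\<^bsub>G\<^esub> c \<Longrightarrow> \<not> c \<rightarrow>\<^bsub>G\<^esub> a"
    and no_C4: "\<And>a b c e. {a, b, c, e} \<subseteq> X \<Longrightarrow> a \<noteq> c \<Longrightarrow> b \<noteq> e \<Longrightarrow>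
      a \<rightarrow>\<^bsub>G\<^esub> b \<Longrightarrow> b \<rightarrow>\<^bsub>G\<^esub> c \<Longrightarrow> c \<rightarrow>\<^bsub>G\<^esub> e \<Longrightarrow> \<not> e \<rightarrow>\<^bsub>G\<^esub> a"
  shows "2 * d \<le> card (S \<inter> X) + 2"
proof -
  let ?T = "S \<inter> X"
  obtain u w where "w \<in> X" and u: "u \<in> ?T" "nbhd_in G X u \<subseteq> insert w ?T"
  proof (cases "X \<subseteq> S")
    case True
    \<comment> \<open>No force takes place; any vertex of \<open>X\<close> can be both
      \<open>u\<close> and \<open>w\<close>.\<close>
    then show ?thesis
      using that \<open>X \<noteq> {}\<close> nbhd_in_subset by (metis all_not_in_conv inf.absorb2 insert_absorb)
  next
    case False
    then have "?T \<subset> X" by auto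
    from forces_withinD[OF forces subset_refl this]
    obtain u w where "u \<in> ?T" "nbhd_in G X u - ?T = {w}" .
    then show ?thesis
      using that[of w u] nbhd_in_subset[of G X u] by blast
  qed
  obtain x y where "x \<noteq> u" "x \<in> X" and x: "insert x (nbhd_in G X x) \<subseteq> insert y (insert w ?T)"
  proof (cases "insert w ?T = X")
    case True
    \<comment> \<open>Everything is coloured, so any second vertex can be \<open>x\<close>, with
      \<open>y = w\<close> as a dummy. The bound \<open>1 \<le> d\<close> provides a neighbour of
      \<open>u\<close>.\<close>
    have "card (nbhd_in G X u) \<noteq> 0" using deg[of u] u \<open>1 \<le> d\<close> by auto
    then obtain x where "x \<in> nbhd_in G X u" by fastforce
    then have "x \<noteq> u" "x \<in> X" using irrefl by (auto simp: nbhd_in_def)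
    then show ?thesis
      using that[of x w] True nbhd_in_subset[of G X x] by auto
  next
    case False
    then have "insert w ?T \<subset> X" using \<open>w \<in> X\<close> by auto
    from forces_withinD[OF forces _ this]
    obtain x y where xy: "x \<in> insert w ?T" "nbhd_in G X x - insert w ?T = {y}" by blast
    \<comment> \<open>All neighbours of \<open>u\<close> are coloured by now, so \<open>u\<close>
      cannot force again.\<close>
    then have "x \<noteq> u" using u by auto
    then show ?thesis
      using that[of x y] xy \<open>w \<in> X\<close> by auto
  qed
  have "2 * d \<le> card (insert u (nbhd_in G X u) \<union> insert x (nbhd_in G X x))"
    using u \<open>x \<noteq> u\<close> \<open>x \<in> X\<close>
    by (intro card_two_closed_nbhds_ge[OF \<open>finite X\<close> _ _ _ irrefl sym deg no_C3 no_C4]) auto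
  also have "\<dots> \<le> card (insert y (insert w ?T))"
    using u x \<open>finite X\<close> by (intro card_mono) auto
  also have "\<dots> \<le> card ?T + 2"
    using \<open>finite X\<close> by (simp add: card_insert_if)
  finally show ?thesis .
qed

section \<open>Girth at least 5 excludes triangles and 4-cycles\<close>

lemma cycle_length_ge_girth:
  assumes "pre_digraph.cycle G p" "3 \<le> length p"
  shows "girth G \<le> enat (length p)"
  unfolding girth_def by (rule INF_lower) (simp add: assms)

lemma dominatesE:
  assumes "u \<rightarrow>\<^bsub>G\<^esub> w"
  obtains e where "e \<in> arcs G" "tail G e = u" "head G e = w"
  using assms by (auto simp: arcs_ends_conv)

text \<open>Choosing one arc per adjacency turns a triangle into an arc list, the form of cycle that
  \<open>girth\<close> measures.\<close>

lemma (in wf_digraph) girth_ge_5_no_C3: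
  assumes "5 \<le> girth G" "a \<rightarrow>\<^bsub>G\<^esub> b" "b \<rightarrow>\<^bsub>G\<^esub> c" "distinct [a, b, c]"
  shows "\<not> c \<rightarrow>\<^bsub>G\<^esub> a"
proof
  assume "c \<rightarrow>\<^bsub>G\<^esub> a"
  obtain e1 where e1: "e1 \<in> arcs G" "tail G e1 = a" "head G e1 = b"
    using \<open>a \<rightarrow>\<^bsub>G\<^esub> b\<close> by (rule dominatesE)
  obtain e2 where e2: "e2 \<in> arcs G" "tail G e2 = b" "head G e2 = c"
    using \<open>b \<rightarrow>\<^bsub>G\<^esub> c\<close> by (rule dominatesE)
  obtain e3 where e3: "e3 \<in> arcs G" "tail G e3 = c" "head G e3 = a"
    using \<open>c \<rightarrow>\<^bsub>G\<^esub> a\<close> by (rule dominatesE)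
  have "awalk a [e1, e2, e3] a"
    using e1 e2 e3 tail_in_verts[OF e1(1)] by (simp add: awalk_def)
  then have "cycle [e1, e2, e3]"
    unfolding cycle_def using e1 e2 e3 assms(4) by (intro exI[of _ a]) auto
  from order_trans[OF assms(1) cycle_length_ge_girth[OF this]] show False
    by (simp add: numeral_eq_enat)
qed

lemma (in wf_digraph) girth_ge_5_no_C4:
  assumes "5 \<le> girth G" "a \<rightarrow>\<^bsub>G\<^esub> b" "b \<rightarrow>\<^bsub>G\<^esub> c" "c \<rightarrow>\<^bsub>G\<^esub> d" "distinct [a, b, c, d]"
  shows "\<not> d \<rightarrow>\<^bsub>G\<^esub> a"
proof
  assume "d \<rightarrow>\<^bsub>G\<^esub> a"
  obtain e1 where e1: "e1 \<in> arcs G" "tail G e1 = a" "head G e1 = b"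
    using \<open>a \<rightarrow>\<^bsub>G\<^esub> b\<close> by (rule dominatesE)
  obtain e2 where e2: "e2 \<in> arcs G" "tail G e2 = b" "head G e2 = c"
    using \<open>b \<rightarrow>\<^bsub>G\<^esub> c\<close> by (rule dominatesE)
  obtain e3 where e3: "e3 \<in> arcs G" "tail G e3 = c" "head G e3 = d"
    using \<open>c \<rightarrow>\<^bsub>G\<^esub> d\<close> by (rule dominatesE)
  obtain e4 where e4: "e4 \<in> arcs G" "tail G e4 = d" "head G e4 = a"
    using \<open>d \<rightarrow>\<^bsub>G\<^esub> a\<close> by (rule dominatesE)
  have "awalk a [e1, e2, e3, e4] a"
    using e1 e2 e3 e4 tail_in_verts[OF e1(1)] by (simp add: awalk_def)
  then have "cycle [e1, e2, e3, e4]"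
    unfolding cycle_def using e1 e2 e3 e4 assms(5) by (intro exI[of _ a]) auto
  from order_trans[OF assms(1) cycle_length_ge_girth[OF this]] show False
    by (simp add: numeral_eq_enat)
qed

section \<open>Degrees, and components after deleting a vertex\<close>

lemma (in digraph) out_degree_eq_card_nbhd_in:
  "out_degree G u = card (nbhd_in G (verts G) u)"
proof -
  have "nbhd_in G (verts G) u = head G ` out_arcs G u"
    by (auto simp: nbhd_in_def arcs_ends_conv)
  \<comment> \<open>Without parallel arcs, counting outgoing arcs amounts to counting
    neighbours.\<close>
  moreover have "inj_on (head G) (out_arcs G u)"
    by (auto intro!: inj_onI no_multi_arcs simp: arc_to_ends_def)
  ultimately show ?thesis
    by (simp add: out_degree_def card_image)
qed

lemma (in fin_digraph) min_degree_le:
  "u \<in> verts G \<Longrightarrow> min_degree G \<le> out_degree G u"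
  by (simp add: min_degree_def)

lemma (in fin_digraph) zero_forcing_number_attained:
  obtains S where "zero_forcing_set G S" "card S = zero_forcing_number G"
proof -
  have "zero_forcing_set G (verts G)" by (simp add: zero_forcing_set_def)
  then have "\<exists>k S. zero_forcing_set G S \<and> card S = k" by blast
  then have "\<exists>S. zero_forcing_set G S \<and> card S = zero_forcing_number G"
    unfolding zero_forcing_number_def by (rule LeastI_ex)
  with that show ?thesis by blast
qed

text \<open>\<open>G\<close> contains \<open>v\<close>, so it has at least one component; hence
  \<open>G - v\<close> has at least two, and they cannot all equal \<open>C\<close>.\<close>

lemma (in fin_digraph) cut_vertex_other_component:
  assumes "cut_vertex G v"
  obtains D where "D \<in> pre_digraph.sccs (del_vert v)" "D \<noteq> C"
proof -
  interpret H: fin_digraph "del_vert v" by (rule fin_digraph_del_vert)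
  have "v \<in> verts G" using assms by (simp add: cut_vertex_def)
  then have "sccs_verts \<noteq> {}" using scc_of_in_sccs_verts by blast
  then have "0 < card sccs" using finite_sccs_verts card_sccs_verts by (metis card_gt_0_iff)
  then have "1 < card (pre_digraph.sccs (del_vert v))"
    using assms by (simp add: cut_vertex_def)
  then have "\<not> H.sccs \<subseteq> {C}"
    using card_mono[of "{C}" "H.sccs"] by auto
  with that show ?thesis by blast
qed

text \<open>By symmetry, adjacent vertices reach each other. This supplies the closure condition of
  \<open>forces_within_closed_subset\<close>.\<close>

lemma (in sym_digraph) sccs_verts_adj_closed:
  assumes "S \<in> sccs_verts" "u \<rightarrow>\<^bsub>G\<^esub> w"
  shows "u \<in> S \<longleftrightarrow> w \<in> S"
proof -
  have "u \<rightarrow>\<^sup>* w" "w \<rightarrow>\<^sup>* u"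
    using assms(2) symmetric_reachable[OF sym_arcs] by auto
  with assms(1) show ?thesis
    unfolding in_sccs_verts_conv_reachable by blast
qed

lemma (in graph) graph_del_vert: "graph (del_vert v)"
proof -
  interpret H: digraph "del_vert v"
    by standard
      (auto simp: pre_digraph.del_vert_simps no_loops arc_to_ends_def intro: no_multi_arcs)
  have "symmetric (del_vert v)"
    using sym_arcs unfolding symmetric_conv by (auto simp: pre_digraph.del_vert_simps)
  then show ?thesis by (rule H.graphI)
qed

lemma dominates_del_vert:
  "u \<rightarrow>\<^bsub>pre_digraph.del_vert G v\<^esub> w \<longleftrightarrow> u \<rightarrow>\<^bsub>G\<^esub> w \<and> u \<noteq> v \<and> w \<noteq> v"
  by (auto simp: arcs_ends_conv pre_digraph.del_vert_simps)

lemma dominates_induced_subgraph: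
  assumes "induced_subgraph H G"
  shows "u \<rightarrow>\<^bsub>H\<^esub> w \<longleftrightarrow> u \<rightarrow>\<^bsub>G\<^esub> w \<and> u \<in> verts H \<and> w \<in> verts H"
  using assms by (auto simp: induced_subgraph_def subgraph_def compatible_def arcs_ends_conv)

text \<open>Every neighbour of \<open>u\<close> other than \<open>v\<close> stays in the component
  of \<open>u\<close>, so at most one neighbour is lost.\<close>

lemma (in graph) component_del_vert_card_nbhd_ge:
  assumes X: "X \<in> pre_digraph.sccs_verts (del_vert v)" and "u \<in> X"
  shows "min_degree G - 1 \<le> card (nbhd_in G X u)"
proof -
  interpret H: graph "del_vert v" by (rule graph_del_vert)
  have sub: "X \<subseteq> verts G - {v}"
    using H.sccs_verts_subsets[OF X] by (simp add: pre_digraph.del_vert_simps)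
  have "nbhd_in G (verts G) u \<subseteq> insert v (nbhd_in G X u)"
    using H.sccs_verts_adj_closed[OF X] \<open>u \<in> X\<close> sub
    by (auto simp: nbhd_in_def dominates_del_vert)
  moreover have "finite (nbhd_in G X u)"
    using sub by (auto intro!: finite_subset[OF subset_trans[OF nbhd_in_subset sub]])
  ultimately have "card (nbhd_in G (verts G) u) \<le> card (insert v (nbhd_in G X u))"
    by (intro card_mono) auto
  also have "\<dots> \<le> Suc (card (nbhd_in G X u))"
    by (rule card_insert_le_m1) auto
  finally have "card (nbhd_in G (verts G) u) \<le> Suc (card (nbhd_in G X u))" .
  moreover have "min_degree G \<le> card (nbhd_in G (verts G) u)"
    using min_degree_le[of u] \<open>u \<in> X\<close> sub by (auto simp: out_degree_eq_card_nbhd_in)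
  ultimately show ?thesis by simp
qed

theorem theorem5:
  fixes G :: "('a, 'b) pre_digraph" and v :: 'a
  assumes "graph G"
    and "3 \<le> min_degree G"
    and "cut_vertex G v"
    and "\<exists>C \<in> pre_digraph.sccs (pre_digraph.del_vert G v). 5 \<le> girth C"
  shows "3 * int (min_degree G) - 6 \<le> int (zero_forcing_number G)"
proof -
  interpret graph G by fact
  interpret H: graph "del_vert v" by (rule graph_del_vert)
  let ?d = "min_degree G - 1"
  obtain C where C: "C \<in> H.sccs" and girth: "5 \<le> girth C" using assms(4) by blast
  obtain D where D: "D \<in> H.sccs" "D \<noteq> C"
    using cut_vertex_other_component[OF assms(3)] .
  have CD: "verts C \<in> H.sccs_verts" "verts D \<in> H.sccs_verts"
    using C D by (auto simp: H.sccs_verts_conv)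
  \<comment> \<open>\<open>C\<close> and \<open>D\<close> differ as subgraphs; disjointness needs
    their vertex sets to differ.\<close>
  have "verts C \<noteq> verts D"
    using H.inj_on_verts_sccs C D by (auto dest: inj_onD)
  then have disj: "verts C \<inter> verts D = {}"
    using CD H.sccs_verts_disjoint by blast
  have component: "X \<subseteq> verts G - {v}" "finite X" "X \<noteq> {}" if "X \<in> H.sccs_verts" for X
    using H.sccs_verts_subsets[OF that] that
    by (auto simp: pre_digraph.del_vert_simps H.in_sccs_verts_conv_reachable intro: finite_subset)
  have irrefl: "\<not> a \<rightarrow>\<^bsub>G\<^esub> a" for a using adj_not_same by blast
  have sym: "b \<rightarrow>\<^bsub>G\<^esub> a" if "a \<rightarrow>\<^bsub>G\<^esub> b" for a b
    using that sym_arcs by (auto simp: symmetric_def dest: symD)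

  obtain S where S: "zero_forcing_set G S" "card S = zero_forcing_number G"
    by (rule zero_forcing_number_attained)
  then have "finite S" by (auto simp: zero_forcing_set_def intro: finite_subset)
  obtain z where z: "forces_within G (verts G - {v}) (insert z S)"
    using forces_within_vertex_deletion[OF S(1)] by blast
  have forces: "forces_within G X (insert z S)" if X: "X \<in> H.sccs_verts" for X
    using H.sccs_verts_adj_closed[OF X] component(1)[OF X]
    by (intro forces_within_closed_subset[OF z]) (auto simp: dominates_del_vert)

  have "?d \<le> card (insert z S \<inter> verts D)"
    using CD(2) component
    by (intro forces_within_card_ge[OF forces _ _ irrefl] component_del_vert_card_nbhd_ge) auto
  moreover have "2 * ?d \<le> card (insert z S \<inter> verts C) + 2"
  proof -
    have ind: "induced_subgraph C (del_vert v)" by (rule H.in_sccs_imp_induced[OF C])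
    then interpret C: wf_digraph C by (auto simp: induced_subgraph_def subgraph_def)
    have adj: "a \<rightarrow>\<^bsub>C\<^esub> b" if "a \<in> verts C" "b \<in> verts C" "a \<rightarrow>\<^bsub>G\<^esub> b" for a b
      using that component(1)[OF CD(1)]
      by (auto simp: dominates_induced_subgraph[OF ind] dominates_del_vert)
    show ?thesis
    proof (rule forces_within_card_ge_girth_5[OF forces[OF CD(1)] component(2,3)[OF CD(1)] _
          irrefl sym component_del_vert_card_nbhd_ge[OF CD(1)]])
      show "1 \<le> ?d" using assms(2) by simp
      show "\<not> c \<rightarrow>\<^bsub>G\<^esub> a" if "{a, b, c} \<subseteq> verts C" "a \<rightarrow>\<^bsub>G\<^esub> b" "b \<rightarrow>\<^bsub>G\<^esub> c" for a b c
      proof -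
        \<comment> \<open>In the degenerate case \<open>c = a\<close> the closing edge would be a
          loop; likewise for \<open>e = a\<close> in the 4-cycle below.\<close>
        have "distinct [a, b, c] \<or> c = a" using that irrefl by auto
        then show ?thesis
          using C.girth_ge_5_no_C3[OF girth adj adj, of a b c] adj[of c a] that irrefl by auto
      qed
      show "\<not> e \<rightarrow>\<^bsub>G\<^esub> a" if "{a, b, c, e} \<subseteq> verts C" "a \<noteq> c" "b \<noteq> e"
        "a \<rightarrow>\<^bsub>G\<^esub> b" "b \<rightarrow>\<^bsub>G\<^esub> c" "c \<rightarrow>\<^bsub>G\<^esub> e" for a b c e
      proof -
        have "distinct [a, b, c, e] \<or> e = a" using that irrefl by auto
        then show ?thesis
          using C.girth_ge_5_no_C4[OF girth adj adj adj, of a b c e] adj[of e a] that irrefl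
          by auto
      qed
    qed
  qed
  \<comment> \<open>As the components are disjoint, \<open>z\<close> is paid for only once.\<close>
  moreover have "card (insert z S \<inter> verts C) + card (insert z S \<inter> verts D) \<le> Suc (card S)"
  proof -
    have "card (insert z S \<inter> verts C) + card (insert z S \<inter> verts D)
        = card (insert z S \<inter> verts C \<union> insert z S \<inter> verts D)"
      using disj \<open>finite S\<close> by (intro card_Un_disjoint[symmetric]) auto
    also have "\<dots> \<le> card (insert z S)"
      using \<open>finite S\<close> by (intro card_mono) auto
    also have "\<dots> \<le> Suc (card S)"
      using \<open>finite S\<close> by (simp add: card_insert_if)
    finally show ?thesis .
  qed
  \<comment> \<open>The bounds add up to \<open>3 * ?d \<le> card S + 3\<close>; since
    \<open>3 \<le> min_degree G\<close>, the subtraction in \<open>?d\<close> is exact.\<close>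
  ultimately show ?thesis
    using S(2) assms(2) by linarith
qed

end
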